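(* Fix $\sigma_\theta,\sigma_x>0$. For each $N\ge1$, let $X_1,\dots,X_N$ be i.i.d. $\mathcal{N}(\theta^\dagger,\sigma_x^2)$ with $\theta^\dagger=1$, and let $$\mu_p=\frac{\sum_{i=1}^N X_i}{\sigma_x^2/\sigma_\theta^2+N},\qquad \sigma_p^2=\left(\frac{1}{\sigma_\theta^2}+\frac{N}{\sigma_x^2}\right)^{-1}$$ be the posterior mean and variance of $\theta$ under the model $\theta\sim\mathcal{N}(0,\sigma_\theta^2)$, $X_i\mid\theta\stackrel{iid}{\sim}\mathcal{N}(\theta,\sigma_x^2)$. Consider the SGLD recursion with $\theta_0=0$, $$\theta_{k+1}=(1-Ah)\theta_k+B_kh+\sqrt h\,\xi_k,\qquad A=\tfrac12\left(\tfrac{1}{\sigma_\theta^2}+\tfrac{N}{\sigma_x^2}\right),\quad B_k=\frac{N}{n}\frac{\sum_{i=1}^n X_{\tau_{ki}}}{2\sigma_x^2},$$ where $\xi_k$ are i.i.d. $\mathcal{N}(0,1)$ and, independently for each $k$, $(\tau_{k1},\dots,\tau_{kn})$ is a random subset of $\{1,\dots,N\}$ of size $n$. Let $\epsilon>0$ and choose $h=N^{-1-\epsilon}$, $M=N^{1+2\epsilon}$ and $n=1$. Then $$\lim_{N\to\infty}\mathbb{E}\left(\frac1M\sum_{j=0}^{M-1}\theta_j^2-(\mu_p^2+\sigma_p^2)\right)^2=0,$$ where the expectation is taken jointly over the data $X_1,\dots,X_N$, the subsampling indices and the Gaussian noise $\xi_k$. *)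

theory Defs
  imports "HOL-Probability.Probability"
begin

definition subsets_of_size :: "nat \<Rightarrow> nat \<Rightarrow> nat set set" where
  "subsets_of_size N n = {S. S \<subseteq> {1..N} \<and> card S = n}"

text \<open>Joint sample space: data X_1..X_N iid N(1, sx^2) (theta-dagger = 1),
  Gaussian noises xi_0..xi_{M-1} iid N(0,1), subsampling subsets tau_0..tau_{M-1}
  iid uniform on subsets of {1..N} of size n; all mutually independent.\<close>
definition sgld_space :: "real \<Rightarrow> nat \<Rightarrow> nat \<Rightarrow> nat \<Rightarrow>
    ((nat \<Rightarrow> real) \<times> (nat \<Rightarrow> real) \<times> (nat \<Rightarrow> nat set)) measure" where
  "sgld_space sx N n M =
     (PiM {1..N} (\<lambda>_. density lborel (normal_density 1 sx)))
     \<Otimes>\<^sub>M ((PiM {..<M} (\<lambda>_. density lborel (normal_density 0 1)))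
     \<Otimes>\<^sub>M (PiM {..<M} (\<lambda>_. measure_pmf (pmf_of_set (subsets_of_size N n)))))"

fun sgld_theta :: "real \<Rightarrow> real \<Rightarrow> (nat \<Rightarrow> real) \<Rightarrow> (nat \<Rightarrow> real) \<Rightarrow> nat \<Rightarrow> real" where
  "sgld_theta A h B xi 0 = 0"
| "sgld_theta A h B xi (Suc k) = (1 - A * h) * sgld_theta A h B xi k + B k * h + sqrt h * xi k"

definition post_mean :: "real \<Rightarrow> real \<Rightarrow> nat \<Rightarrow> (nat \<Rightarrow> real) \<Rightarrow> real" where
  "post_mean st sx N X = (\<Sum>i=1..N. X i) / (sx\<^sup>2 / st\<^sup>2 + real N)"

definition post_var :: "real \<Rightarrow> real \<Rightarrow> nat \<Rightarrow> real" where
  "post_var st sx N = inverse (1 / st\<^sup>2 + real N / sx\<^sup>2)"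

end

theory Submission
  imports Defs "HOL-Real_Asymp.Real_Asymp"
begin

text \<open>
  Write \<open>D\<^sub>j = \<theta>\<^sub>j - \<mu>\<^sub>p\<close> and \<open>a = A h\<close>. Since \<open>\<mu>\<^sub>p\<close> is the fixed point of the averaged recursion,
  \<open>D\<^sub>j\<^sub>+\<^sub>1 = (1 - a) D\<^sub>j + \<eta>\<^sub>j\<close>, where, given the data, \<open>\<eta>\<^sub>j\<close> is centred and independent of \<open>D\<^sub>j\<close>.
  The pointwise bound \<open>((1 - a) D + \<eta>)\<^sup>4 \<le> (1 - a) D\<^sup>4 + 4 (1 - a)\<^sup>3 D\<^sup>3 \<eta> + (19 / a) \<eta>\<^sup>4\<close> then
  gives a contracting recursion for the conditional fourth moments of \<open>D\<^sub>j\<close>; averaged over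
  \<open>j < M\<close> they are of order \<open>\<mu>\<^sub>p\<^sup>4 / (M a) + E \<eta>\<^sup>4 / a\<^sup>2\<close>. After integrating over the data this is
  \<open>O(N\<^sup>-\<^sup>1\<^sup>-\<^sup>\<epsilon> + N\<^sup>-\<^sup>2\<^sup>\<epsilon> + N\<^sup>-\<^sup>2)\<close>, and \<open>\<theta>\<^sub>j\<^sup>2 - \<mu>\<^sub>p\<^sup>2 = D\<^sub>j\<^sup>2 + 2 \<mu>\<^sub>p D\<^sub>j\<close> is controlled by the fourth
  moments of \<open>D\<^sub>j\<close> and \<open>\<mu>\<^sub>p\<close>. The posterior variance itself tends to zero.
\<close>

section \<open>Elementary inequalities for fourth powers\<close>

text \<open>The term linear in \<open>e\<close> is kept exactly, because it averages to zero when
  \<open>e\<close> is centred and independent of \<open>D\<close>. Every other term in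
  \<open>e\<close> is split between \<open>D ^ 4\<close> and \<open>e ^ 4\<close>, and the slack
  \<open>a\<close> of the contraction pays for the first share.\<close>

lemma fourth_power_step_le:
  fixes D e a :: real
  assumes "0 < a" "a \<le> 1"
  shows "((1 - a) * D + e) ^ 4 \<le> (1 - a) * D ^ 4 + 4 * (1 - a) ^ 3 * D ^ 3 * e + 19 / a * e ^ 4"
proof -
  define r where "r = 1 - a"
  have r: "0 \<le> r" "r \<le> 1" using assms by (auto simp: r_def)
  have r2: "r\<^sup>2 \<le> r" using r by (simp add: power2_eq_square mult_left_le)
  \<comment> \<open>The subtracted square removes the odd term \<open>4 * r * D * e ^ 3\<close>, so
    that only even powers remain beside the linear term.\<close>
  have "(r * D + e) ^ 4 = r ^ 4 * D ^ 4 + 4 * r ^ 3 * D ^ 3 * e + 8 * r\<^sup>2 * D\<^sup>2 * e\<^sup>2 + 3 * e ^ 4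
      - 2 * (e * (r * D - e))\<^sup>2"
    by (simp add: algebra_simps power2_eq_square power3_eq_cube power4_eq_xxxx)
  then have 1: "(r * D + e) ^ 4 \<le> r ^ 4 * D ^ 4 + 4 * r ^ 3 * D ^ 3 * e + 8 * r\<^sup>2 * D\<^sup>2 * e\<^sup>2 + 3 * e ^ 4"
    by simp
  \<comment> \<open>Young's inequality, weighted so that the \<open>D\<^sup>4\<close> part is absorbed by the contraction.\<close>
  have "8 * D\<^sup>2 * e\<^sup>2 = a * D ^ 4 + 16 * e ^ 4 / a - (a * D\<^sup>2 - 4 * e\<^sup>2)\<^sup>2 / a"
    using assms by (simp add: field_simps power2_eq_square power4_eq_xxxx)
  then have "8 * D\<^sup>2 * e\<^sup>2 \<le> a * D ^ 4 + 16 * e ^ 4 / a"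
    using assms by simp
  then have 2: "r\<^sup>2 * (8 * D\<^sup>2 * e\<^sup>2) \<le> r\<^sup>2 * (a * D ^ 4 + 16 * e ^ 4 / a)"
    by (intro mult_left_mono) auto
  \<comment> \<open>Here \<open>r + a = 1\<close>, so adding the Young share \<open>a\<close> still
    leaves a coefficient of at most \<open>r\<close>.\<close>
  have "r\<^sup>2 * (r\<^sup>2 + a) \<le> r\<^sup>2 * (r + a)" using r2 by (intro mult_left_mono) auto
  also have "\<dots> = r\<^sup>2" by (simp add: r_def)
  finally have "r\<^sup>2 * (r\<^sup>2 + a) \<le> r" using r2 by simp
  then have 3: "r\<^sup>2 * (r\<^sup>2 + a) * D ^ 4 \<le> r * D ^ 4" by (intro mult_right_mono) auto
  \<comment> \<open>The constant 19 is 16 from Young's inequality plus 3 from the expansion, using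
    \<open>3 \<le> 3 / a\<close>.\<close>
  have "16 * r\<^sup>2 / a + 3 \<le> 16 * 1 / a + 3 / a"
    using assms r r2 by (intro add_mono divide_right_mono mult_left_mono) (auto simp: field_simps)
  then have 4: "(16 * r\<^sup>2 / a + 3) * e ^ 4 \<le> 19 / a * e ^ 4"
    by (intro mult_right_mono) auto
  have "r ^ 4 * D ^ 4 = r\<^sup>2 * r\<^sup>2 * D ^ 4" by (simp add: power2_eq_square power4_eq_xxxx)
  then show ?thesis
    using 1 2 3 4 unfolding r_def[symmetric] by (simp add: algebra_simps)
qed

text \<open>Convexity of the fourth power: \<open>(x - y)\<^sup>2\<close> factors out of the
  difference, and the cofactor is a sum of squares.\<close>

lemma fourth_power_add_le: "(x + y) ^ 4 \<le> 8 * x ^ 4 + 8 * y ^ 4" for x y :: real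
proof -
  have "8 * x ^ 4 + 8 * y ^ 4 - (x + y) ^ 4 = (x - y)\<^sup>2 * (7 * x\<^sup>2 + 10 * (x * y) + 7 * y\<^sup>2)"
    by (simp add: algebra_simps power2_eq_square power4_eq_xxxx)
  moreover have "7 * x\<^sup>2 + 10 * (x * y) + 7 * y\<^sup>2 = 5 * (x + y)\<^sup>2 + 2 * x\<^sup>2 + 2 * y\<^sup>2"
    by (simp add: algebra_simps power2_eq_square)
  moreover have "\<dots> \<ge> 0" by simp
  ultimately show ?thesis
    by (smt (verit) mult_nonneg_nonneg zero_le_power2)
qed

text \<open>Cauchy-Schwarz against the constant 1, applied first to \<open>X\<close> and then to its
  squares.\<close>

lemma sum_power4_le:
  fixes X :: "'a \<Rightarrow> real"
  assumes "finite I"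
  shows "(\<Sum>i\<in>I. X i) ^ 4 \<le> real (card I) ^ 3 * (\<Sum>i\<in>I. X i ^ 4)"
proof -
  have cs: "(\<Sum>i\<in>I. f i)\<^sup>2 \<le> real (card I) * (\<Sum>i\<in>I. (f i)\<^sup>2)" for f :: "'a \<Rightarrow> real"
    using sum_squared_le_sum_of_squares[of f I] by (simp add: mult.commute)
  have "(\<Sum>i\<in>I. X i) ^ 4 = ((\<Sum>i\<in>I. X i)\<^sup>2)\<^sup>2" by simp
  also have "\<dots> \<le> (real (card I) * (\<Sum>i\<in>I. (X i)\<^sup>2))\<^sup>2"
    by (intro power_mono cs) auto
  also have "\<dots> = (real (card I))\<^sup>2 * (\<Sum>i\<in>I. (X i)\<^sup>2)\<^sup>2" by (simp add: power_mult_distrib)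
  also have "\<dots> \<le> (real (card I))\<^sup>2 * (real (card I) * (\<Sum>i\<in>I. ((X i)\<^sup>2)\<^sup>2))"
    by (intro mult_left_mono cs) auto
  finally show ?thesis by (simp add: power2_eq_square power3_eq_cube mult.assoc power4_eq_xxxx)
qed

section \<open>Integrals over product measures\<close>

text \<open>One half of Tonelli's theorem, needing no measurability of the integrand. It spares the joint
  measurability of \<open>\<Sum>i\<in>\<tau>\<^sub>k. X\<^sub>i\<close> in the data and the subset, whose type is uncountable.\<close>
lemma nn_integral_pair_measure_le:
  assumes "sigma_finite_measure N"
  shows "(\<integral>\<^sup>+ z. f z \<partial>(M \<Otimes>\<^sub>M N)) \<le> (\<integral>\<^sup>+ x. \<integral>\<^sup>+ y. f (x, y) \<partial>N \<partial>M)"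
proof -
  interpret sigma_finite_measure N by fact
  show ?thesis
    unfolding nn_integral_def[of "M \<Otimes>\<^sub>M N"]
  proof (rule SUP_least, safe)
    fix g
    assume g: "simple_function (M \<Otimes>\<^sub>M N) g" "g \<le> f"
    have "integral\<^sup>S (M \<Otimes>\<^sub>M N) g = (\<integral>\<^sup>+ z. g z \<partial>(M \<Otimes>\<^sub>M N))"
      using g by (simp add: nn_integral_eq_simple_integral)
    also have "\<dots> = (\<integral>\<^sup>+ x. \<integral>\<^sup>+ y. g (x, y) \<partial>N \<partial>M)"
      using g by (intro nn_integral_fst[symmetric] borel_measurable_simple_function)
    also have "\<dots> \<le> (\<integral>\<^sup>+ x. \<integral>\<^sup>+ y. f (x, y) \<partial>N \<partial>M)"
      using g(2) by (intro nn_integral_mono) (auto simp: le_fun_def)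
    finally show "integral\<^sup>S (M \<Otimes>\<^sub>M N) g \<le> \<dots>" .
  qed
qed

text \<open>Redrawing one coordinate from its own marginal preserves the product law. The fresh draw
  becomes an inner integral, while the outer one still runs over the whole product; conditioning on
  the past is expressed in this way.\<close>

lemma nn_integral_PiM_resample:
  assumes M: "\<And>i. prob_space (M i)" and I: "finite I" "j \<in> I"
    and f: "f \<in> borel_measurable (PiM I M)"
  shows "(\<integral>\<^sup>+ x. f x \<partial>PiM I M) = (\<integral>\<^sup>+ x. \<integral>\<^sup>+ y. f (x(j := y)) \<partial>M j \<partial>PiM I M)"
proof -
  interpret product_prob_space M I by (intro product_prob_spaceI M)
  have ins: "insert j (I - {j}) = I" using I by auto
  have 1: "(\<integral>\<^sup>+ x. g x \<partial>PiM I M) = (\<integral>\<^sup>+ x. \<integral>\<^sup>+ y. g (x(j := y)) \<partial>M j \<partial>PiM (I - {j}) M)"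
    if "g \<in> borel_measurable (PiM I M)" for g
    using product_nn_integral_insert[of "I - {j}" j g, unfolded ins] I that by simp
  have upd: "(\<lambda>(x, y). x(j := y)) \<in> PiM I M \<Otimes>\<^sub>M M j \<rightarrow>\<^sub>M PiM I M"
    using measurable_add_dim[of j I M] I by (simp add: insert_absorb)
  have m: "(\<lambda>x. \<integral>\<^sup>+ y. f (x(j := y)) \<partial>M j) \<in> borel_measurable (PiM I M)"
    using measurable_compose[OF upd f] by (intro M.borel_measurable_nn_integral) (simp add: case_prod_unfold)
  \<comment> \<open>Both sides reduce to \<open>I - {j}\<close>. On the right the second draw
    overwrites the first, whose integral is then that of a constant over a probability
    space.\<close>
  show ?thesis
    by (subst (1 2) 1) (use f m in \<open>simp_all add: M.emeasure_space_1\<close>)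
qed

section \<open>Structure of the recursion\<close>

text \<open>Iterate \<open>j\<close> sees only inputs of index below \<open>j\<close>, so resampling
  coordinate \<open>j\<close> leaves it unchanged. This plays the part of independence between the
  current state and the next noise.\<close>

lemma sgld_theta_cong:
  "(\<And>k. k < j \<Longrightarrow> B k = B' k) \<Longrightarrow> (\<And>k. k < j \<Longrightarrow> xi k = xi' k) \<Longrightarrow>
    sgld_theta A h B xi j = sgld_theta A h B' xi' j"
  by (induction j) auto

text \<open>Holds for any \<open>m\<close>; the last bracket is centred once \<open>A * m\<close> is
  the mean of \<open>B j\<close>.\<close>

lemma sgld_theta_center:
  "sgld_theta A h B xi (Suc j) - m =
    (1 - A * h) * (sgld_theta A h B xi j - m) + (h * (B j - A * m) + sqrt h * xi j)"
  by (simp add: algebra_simps)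

section \<open>Gaussian moments\<close>

text \<open>The moments of order 0, 1 and 4 are 1, 0 and 3. Nonnegativity of the whole polynomial
  carries the cancellation of the signed linear term over to the nonnegative integral.\<close>

lemma nn_integral_std_normal_quartic:
  fixes c0 c1 c4 :: real
  assumes nonneg: "\<And>y. 0 \<le> c0 + c1 * y + c4 * y ^ 4"
  shows "(\<integral>\<^sup>+ y. ennreal (c0 + c1 * y + c4 * y ^ 4) \<partial>density lborel (normal_density 0 1))
    = ennreal (c0 + 3 * c4)"
proof -
  have "has_bochner_integral lborel (\<lambda>y. normal_density 0 1 y * (c0 + c1 * y + c4 * y ^ 4)) (c0 + 3 * c4)"
  proof -
    have m0: "has_bochner_integral lborel (\<lambda>y. std_normal_density y * c0) (1 * c0)"
      using std_normal_moment_even[of 0] by (intro has_bochner_integral_mult_left) simp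
    have m1: "has_bochner_integral lborel (\<lambda>y. std_normal_density y * y * c1) (0 * c1)"
      using std_normal_moment_odd[of 0] by (intro has_bochner_integral_mult_left) simp
    have m4: "has_bochner_integral lborel (\<lambda>y. std_normal_density y * y ^ 4 * c4) (3 * c4)"
      using std_normal_moment_even[of 2]
      by (intro has_bochner_integral_mult_left) (simp add: fact_numeral)
    show ?thesis
      using has_bochner_integral_add[OF has_bochner_integral_add[OF m0 m1] m4]
      by (simp add: algebra_simps)
  qed
  then have "integral\<^sup>N lborel (\<lambda>y. ennreal (normal_density 0 1 y * (c0 + c1 * y + c4 * y ^ 4))) = ennreal (c0 + 3 * c4)"
    by (subst nn_integral_eq_integral)
       (auto simp: has_bochner_integral_iff normal_density_nonneg nonneg)
  then show ?thesis
    by (subst nn_integral_density) (auto simp: ennreal_mult' normal_density_nonneg)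
qed

text \<open>Writing \<open>x\<close> as \<open>(x - m) + m\<close> reduces this to the central
  moment \<open>3 * s ^ 4\<close>.\<close>

lemma nn_integral_normal_fourth_moment_le:
  assumes "0 < s"
  shows "(\<integral>\<^sup>+ x. ennreal (x ^ 4) \<partial>density lborel (normal_density m s)) \<le> ennreal (8 * (3 * s ^ 4) + 8 * m ^ 4)"
proof -
  have m0: "has_bochner_integral lborel (\<lambda>x. normal_density m s x * (8 * m ^ 4)) (1 * (8 * m ^ 4))"
    using normal_moment_even[OF assms, of m 0] by (intro has_bochner_integral_mult_left) simp
  have m4: "has_bochner_integral lborel (\<lambda>x. normal_density m s x * (x - m) ^ 4 * 8) ((3 * s ^ 4) * 8)"
    using normal_moment_even[OF assms, of m 2] assms
    by (intro has_bochner_integral_mult_left) (simp add: fact_numeral field_simps)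
  have "has_bochner_integral lborel (\<lambda>x. normal_density m s x * (8 * (x - m) ^ 4 + 8 * m ^ 4)) (8 * (3 * s ^ 4) + 8 * m ^ 4)"
    using has_bochner_integral_add[OF m4 m0] by (simp add: algebra_simps)
  then have eq: "integral\<^sup>N lborel (\<lambda>x. ennreal (normal_density m s x * (8 * (x - m) ^ 4 + 8 * m ^ 4)))
      = ennreal (8 * (3 * s ^ 4) + 8 * m ^ 4)"
    by (subst nn_integral_eq_integral) (auto simp: has_bochner_integral_iff normal_density_nonneg)
  have "(\<integral>\<^sup>+ x. ennreal (x ^ 4) \<partial>density lborel (normal_density m s))
      = integral\<^sup>N lborel (\<lambda>x. ennreal (normal_density m s x * x ^ 4))"
    by (subst nn_integral_density) (auto simp: ennreal_mult' normal_density_nonneg)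
  also have "\<dots> \<le> integral\<^sup>N lborel (\<lambda>x. ennreal (normal_density m s x * (8 * (x - m) ^ 4 + 8 * m ^ 4)))"
    using fourth_power_add_le[of "_ - m" m]
    by (intro nn_integral_mono ennreal_leI mult_left_mono) (auto simp: normal_density_nonneg)
  finally show ?thesis by (simp add: eq)
qed

section \<open>Fourth moments of the deviation for fixed data\<close>

text \<open>With the data frozen, \<open>b\<close> is a function on a space where every set is
  measurable, so it may be arbitrary.\<close>

lemma measurable_sgld_theta [measurable]:
  fixes b :: "'t \<Rightarrow> real"
  shows "j \<le> M \<Longrightarrow> (\<lambda>z. sgld_theta A h (\<lambda>k. b (snd z k)) (fst z) j)
    \<in> borel_measurable (PiM {..<M} (\<lambda>_. density lborel (normal_density 0 1)) \<Otimes>\<^sub>M PiM {..<M} (\<lambda>_. measure_pmf p))"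
proof (induction j)
  case (Suc j)
  let ?P = "PiM {..<M} (\<lambda>_. density lborel (normal_density 0 1)) \<Otimes>\<^sub>M PiM {..<M} (\<lambda>_. measure_pmf p)"
  have [measurable]: "(\<lambda>z. fst z j) \<in> borel_measurable ?P"
    using Suc.prems measurable_component_singleton[of j "{..<M}" "\<lambda>_. density lborel (normal_density 0 1)"]
    by (intro measurable_compose[OF measurable_fst]) simp
  have [measurable]: "(\<lambda>z. b (snd z j)) \<in> borel_measurable ?P"
    using Suc.prems measurable_component_singleton[of j "{..<M}" "\<lambda>_. measure_pmf p"]
    by (intro measurable_compose[OF measurable_snd] measurable_compose[of "\<lambda>x. x j" _ "measure_pmf p" b]) auto
  show ?case using Suc by simp
qed simp

text \<open>The data are frozen: \<open>S\<close> is the set of possible subsets, \<open>b s\<close>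
  the drift computed from \<open>s\<close>, and \<open>m\<close> will be the posterior mean.
  \<open>b_mean\<close> makes the subsampled drift unbiased at \<open>m\<close>, and
  \<open>Q\<close> bounds the fourth moment of the subsampling noise.\<close>

context
  fixes A h m Q :: real and b :: "'t \<Rightarrow> real" and S :: "'t set" and M :: nat
  assumes h: "0 < h" and a: "0 < A * h" "A * h \<le> 1"
    and S: "finite S" "S \<noteq> {}"
    and b_mean: "(\<Sum>s\<in>S. b s) = real (card S) * (A * m)"
    and b_fourth: "(\<Sum>s\<in>S. (h * (b s - A * m)) ^ 4) \<le> real (card S) * Q"
begin

private abbreviation "NM \<equiv> PiM {..<M} (\<lambda>_. density lborel (normal_density 0 1))"
private abbreviation "TM \<equiv> PiM {..<M} (\<lambda>_. measure_pmf (pmf_of_set S))"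
private abbreviation "dev \<equiv> \<lambda>(xi, tau) j. sgld_theta A h (\<lambda>k. b (tau k)) xi j - m"

private lemma Q_nonneg: "0 \<le> Q"
proof -
  have "0 \<le> real (card S) * Q" by (rule order_trans[OF _ b_fourth]) (auto intro: sum_nonneg)
  then show ?thesis using S by (simp add: zero_le_mult_iff card_gt_0_iff)
qed

text \<open>The pointwise quartic bound is averaged over the two inputs of step \<open>j\<close>,
  which kills its linear terms. The constant 152 is \<open>8 * 19\<close>, the 8 coming from
  separating the subsampling noise from the Gaussian noise, and \<open>3 * h\<^sup>2\<close> is the
  fourth moment of the latter.\<close>

lemma sgld_fourth_moment_Suc_le:
  assumes j: "j < M"
  shows "(\<integral>\<^sup>+ z. ennreal ((dev z (Suc j)) ^ 4) \<partial>(NM \<Otimes>\<^sub>M TM)) \<le>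
    ennreal (1 - A * h) * (\<integral>\<^sup>+ z. ennreal ((dev z j) ^ 4) \<partial>(NM \<Otimes>\<^sub>M TM))
      + ennreal (152 / (A * h) * (Q + 3 * h\<^sup>2))"
proof -
  define r where "r = 1 - A * h"
  define c where "c = 152 / (A * h)"
  define u where "u s = h * (b s - A * m)" for s
  have r0: "0 \<le> r" and c0: "0 < c" using a by (auto simp: r_def c_def)
  have cS: "0 < card S" using S by (simp add: card_gt_0_iff)
  have u_mean: "(\<Sum>s\<in>S. u s) = 0"
    using b_mean by (simp add: u_def sum_distrib_left[symmetric] sum_subtractf)
  interpret NM: prob_space NM by (intro prob_space_PiM prob_space_normal_density) simp
  interpret TM: prob_space TM by (intro prob_space_PiM) (simp add: prob_space_measure_pmf)
  interpret P: pair_sigma_finite NM TM ..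
  have mD [measurable]: "(\<lambda>z. dev z i) \<in> borel_measurable (NM \<Otimes>\<^sub>M TM)" if "i \<le> M" for i
    using measurable_sgld_theta[OF that, of A h b "pmf_of_set S"] by (simp add: case_prod_unfold)
  have mu: "(\<lambda>z. u (snd z j)) \<in> borel_measurable (NM \<Otimes>\<^sub>M TM)"
    using j measurable_component_singleton[of j "{..<M}" "\<lambda>_. measure_pmf (pmf_of_set S)"]
    by (intro measurable_compose[OF measurable_snd] measurable_compose[of "\<lambda>x. x j" _ "measure_pmf (pmf_of_set S)" u]) auto
  note [measurable] = mD[of j] mD[of "Suc j"] mu
  \<comment> \<open>\<open>G D w\<close> is the bound once the Gaussian noise is averaged out, for
    deviation \<open>D\<close> and subsampling error \<open>w\<close>.\<close>
  define G where "G D w = r * D ^ 4 + 4 * r ^ 3 * D ^ 3 * w + c * (w ^ 4 + 3 * h\<^sup>2)" for D w :: real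
  have step: "(r * D + (w + sqrt h * y)) ^ 4
      \<le> (r * D ^ 4 + 4 * r ^ 3 * D ^ 3 * w + c * w ^ 4) + 4 * r ^ 3 * D ^ 3 * sqrt h * y + c * h\<^sup>2 * y ^ 4"
    for D w y
  proof -
    have "sqrt h ^ 4 = h\<^sup>2" using h by (simp add: power4_eq_xxxx power2_eq_square)
    then have "(w + sqrt h * y) ^ 4 \<le> 8 * w ^ 4 + 8 * (h\<^sup>2 * y ^ 4)"
      using fourth_power_add_le[of w "sqrt h * y"] by (simp add: power_mult_distrib)
    then have "19 / (A * h) * (w + sqrt h * y) ^ 4 \<le> 19 / (A * h) * (8 * w ^ 4 + 8 * (h\<^sup>2 * y ^ 4))"
      using a by (intro mult_left_mono) auto
    also have "\<dots> = c * w ^ 4 + c * h\<^sup>2 * y ^ 4" by (simp add: c_def algebra_simps)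
    finally show ?thesis
      using fourth_power_step_le[OF a, of D "w + sqrt h * y"] unfolding r_def[symmetric]
      by (simp add: algebra_simps)
  qed
  \<comment> \<open>Taking \<open>y = 0\<close> in \<open>step\<close> puts \<open>G D w\<close>
    above a fourth power.\<close>
  have G0: "0 \<le> G D w" for D w
    using step[of D w 0] c0 zero_le_even_power[of 4 "r * D + w"] unfolding G_def
    by (smt (verit) distrib_left even_numeral mult_nonneg_nonneg mult_zero_right power_zero_numeral zero_le_power2)
  have noise: "(\<integral>\<^sup>+ y. ennreal ((r * D + (w + sqrt h * y)) ^ 4) \<partial>density lborel (normal_density 0 1)) \<le> ennreal (G D w)"
    for D w
  proof -
    have "(\<integral>\<^sup>+ y. ennreal ((r * D + (w + sqrt h * y)) ^ 4) \<partial>density lborel (normal_density 0 1)) \<le>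
      (\<integral>\<^sup>+ y. ennreal ((r * D ^ 4 + 4 * r ^ 3 * D ^ 3 * w + c * w ^ 4) + 4 * r ^ 3 * D ^ 3 * sqrt h * y + c * h\<^sup>2 * y ^ 4) \<partial>density lborel (normal_density 0 1))"
      by (intro nn_integral_mono ennreal_leI step)
    also have "\<dots> = ennreal ((r * D ^ 4 + 4 * r ^ 3 * D ^ 3 * w + c * w ^ 4) + 3 * (c * h\<^sup>2))"
      by (intro nn_integral_std_normal_quartic order_trans[OF _ step]) auto
    also have "\<dots> = ennreal (G D w)" by (simp add: G_def algebra_simps)
    finally show ?thesis .
  qed
  have subsample: "(\<integral>\<^sup>+ t. ennreal (G D (u t)) \<partial>measure_pmf (pmf_of_set S)) \<le> ennreal (r * D ^ 4 + c * (Q + 3 * h\<^sup>2))"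
    for D
  proof -
    have "(\<integral>\<^sup>+ t. ennreal (G D (u t)) \<partial>measure_pmf (pmf_of_set S)) = ennreal ((\<Sum>s\<in>S. G D (u s)) / card S)"
      using S cS G0 by (simp add: nn_integral_pmf_of_set ennreal_of_nat_eq_real_of_nat divide_ennreal sum_nonneg)
    also have "(\<Sum>s\<in>S. G D (u s)) = card S * (r * D ^ 4) + 4 * r ^ 3 * D ^ 3 * (\<Sum>s\<in>S. u s)
        + c * ((\<Sum>s\<in>S. u s ^ 4) + card S * (3 * h\<^sup>2))"
      by (simp add: G_def sum.distrib sum_distrib_left sum_distrib_right algebra_simps)
    also have "\<dots> \<le> card S * (r * D ^ 4) + c * (card S * Q + card S * (3 * h\<^sup>2))"
      using b_fourth[folded u_def] c0 by (simp add: u_mean)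
    also have "\<dots> = (r * D ^ 4 + c * (Q + 3 * h\<^sup>2)) * card S" by (simp add: algebra_simps)
    finally show ?thesis using cS by (simp add: divide_right_mono ennreal_leI pos_divide_le_eq)
  qed
  have dev_upd: "dev (xi(j := y), tau) j = dev (xi, tau) j" "dev (xi, tau(j := t)) j = dev (xi, tau) j" for xi tau y t
    by (auto intro!: sgld_theta_cong)
  have dev_Suc: "dev (xi, tau) (Suc j) = r * dev (xi, tau) j + (u (tau j) + sqrt h * xi j)" for xi tau
    unfolding prod.case r_def u_def by (rule sgld_theta_center)
  \<comment> \<open>Each family of inputs is resampled while it is the innermost variable: first
    \<open>xi\<close>, then, after a Fubini swap, \<open>tau\<close>.\<close>
  have "(\<integral>\<^sup>+ z. ennreal ((dev z (Suc j)) ^ 4) \<partial>(NM \<Otimes>\<^sub>M TM)) =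
      (\<integral>\<^sup>+ tau. \<integral>\<^sup>+ xi. ennreal ((dev (xi, tau) (Suc j)) ^ 4) \<partial>NM \<partial>TM)"
    using j by (intro P.nn_integral_snd[symmetric]) measurable
  also have "\<dots> \<le> (\<integral>\<^sup>+ tau. \<integral>\<^sup>+ xi. ennreal (G (dev (xi, tau) j) (u (tau j))) \<partial>NM \<partial>TM)"
  proof (rule nn_integral_mono)
    fix tau assume tau: "tau \<in> space TM"
    have "(\<integral>\<^sup>+ xi. ennreal ((dev (xi, tau) (Suc j)) ^ 4) \<partial>NM) =
      (\<integral>\<^sup>+ xi. \<integral>\<^sup>+ y. ennreal ((dev (xi(j := y), tau) (Suc j)) ^ 4) \<partial>density lborel (normal_density 0 1) \<partial>NM)"
      using j measurable_compose[OF measurable_Pair2'[OF tau] mD[of "Suc j"]]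
      by (intro nn_integral_PiM_resample prob_space_normal_density) auto
    also have "\<dots> \<le> (\<integral>\<^sup>+ xi. ennreal (G (dev (xi, tau) j) (u (tau j))) \<partial>NM)"
      unfolding dev_Suc dev_upd by (intro nn_integral_mono) (simp only: fun_upd_same noise)
    finally show "(\<integral>\<^sup>+ xi. ennreal ((dev (xi, tau) (Suc j)) ^ 4) \<partial>NM) \<le> \<dots>" .
  qed
  also have "\<dots> = (\<integral>\<^sup>+ xi. \<integral>\<^sup>+ tau. ennreal (G (dev (xi, tau) j) (u (tau j))) \<partial>TM \<partial>NM)"
    using j unfolding G_def by (intro P.Fubini') (simp add: case_prod_unfold)
  also have "\<dots> \<le> (\<integral>\<^sup>+ xi. \<integral>\<^sup>+ tau. ennreal (r * dev (xi, tau) j ^ 4 + c * (Q + 3 * h\<^sup>2)) \<partial>TM \<partial>NM)"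
  proof (rule nn_integral_mono)
    fix xi assume xi: "xi \<in> space NM"
    have "(\<integral>\<^sup>+ tau. ennreal (G (dev (xi, tau) j) (u (tau j))) \<partial>TM) =
      (\<integral>\<^sup>+ tau. \<integral>\<^sup>+ t. ennreal (G (dev (xi, tau(j := t)) j) (u ((tau(j := t)) j))) \<partial>measure_pmf (pmf_of_set S) \<partial>TM)"
      using j measurable_compose[OF measurable_Pair1'[OF xi] mD[of j]]
        measurable_compose[OF measurable_Pair1'[OF xi] mu]
      unfolding G_def
      by (intro nn_integral_PiM_resample) (auto simp: prob_space_measure_pmf)
    also have "\<dots> \<le> (\<integral>\<^sup>+ tau. ennreal (r * dev (xi, tau) j ^ 4 + c * (Q + 3 * h\<^sup>2)) \<partial>TM)"
      unfolding dev_upd by (intro nn_integral_mono) (simp only: fun_upd_same subsample)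
    finally show "(\<integral>\<^sup>+ tau. ennreal (G (dev (xi, tau) j) (u (tau j))) \<partial>TM) \<le> \<dots>" .
  qed
  also have "\<dots> = (\<integral>\<^sup>+ z. ennreal (r * dev z j ^ 4 + c * (Q + 3 * h\<^sup>2)) \<partial>(NM \<Otimes>\<^sub>M TM))"
    using j by (intro TM.nn_integral_fst) measurable
  also have "\<dots> = (\<integral>\<^sup>+ z. ennreal r * ennreal (dev z j ^ 4) + ennreal (c * (Q + 3 * h\<^sup>2)) \<partial>(NM \<Otimes>\<^sub>M TM))"
    using r0 c0 Q_nonneg by (simp flip: ennreal_mult' ennreal_plus)
  also have "\<dots> = ennreal r * (\<integral>\<^sup>+ z. ennreal (dev z j ^ 4) \<partial>(NM \<Otimes>\<^sub>M TM)) + ennreal (c * (Q + 3 * h\<^sup>2))"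
  proof -
    interpret PP: pair_prob_space NM TM ..
    show ?thesis
      using j PP.emeasure_space_1 by (simp add: nn_integral_add nn_integral_cmult)
  qed
  finally show ?thesis by (simp add: r_def c_def)
qed

text \<open>The one-step bound is iterated from \<open>dev z 0 = - m\<close>. With
  \<open>a = A * h\<close> and \<open>K = 152 * (Q + 3 * h\<^sup>2)\<close>, the value
  \<open>K / a\<^sup>2\<close> is the fixed point of the map sending \<open>x\<close> to
  \<open>(1 - a) * x + K / a\<close>.\<close>

lemma sgld_fourth_moment_le:
  assumes "j \<le> M"
  shows "(\<integral>\<^sup>+ z. ennreal ((dev z j) ^ 4) \<partial>(NM \<Otimes>\<^sub>M TM)) \<le>
    ennreal ((1 - A * h) ^ j * m ^ 4 + 152 * (Q + 3 * h\<^sup>2) / (A * h)\<^sup>2)"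
  using assms
proof (induction j)
  case 0
  interpret NM: prob_space NM by (intro prob_space_PiM prob_space_normal_density) simp
  interpret TM: prob_space TM by (intro prob_space_PiM) (simp add: prob_space_measure_pmf)
  interpret PP: pair_prob_space NM TM ..
  show ?case using PP.emeasure_space_1 Q_nonneg by (simp add: case_prod_unfold ennreal_leI)
next
  case (Suc j)
  define a where "a = A * h"
  define K where "K = 152 * (Q + 3 * h\<^sup>2)"
  have a01: "0 < a" "a \<le> 1" using a by (auto simp: a_def)
  have K0: "0 \<le> K" using Q_nonneg by (simp add: K_def)
  have "(\<integral>\<^sup>+ z. ennreal ((dev z (Suc j)) ^ 4) \<partial>(NM \<Otimes>\<^sub>M TM)) \<le>
      ennreal (1 - a) * (\<integral>\<^sup>+ z. ennreal ((dev z j) ^ 4) \<partial>(NM \<Otimes>\<^sub>M TM)) + ennreal (K / a)"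
    using sgld_fourth_moment_Suc_le[of j] Suc.prems by (simp add: a_def K_def)
  also have "\<dots> \<le> ennreal (1 - a) * ennreal ((1 - a) ^ j * m ^ 4 + K / a\<^sup>2) + ennreal (K / a)"
    using Suc by (intro add_mono mult_left_mono) (auto simp: a_def K_def)
  also have "\<dots> = ennreal ((1 - a) * ((1 - a) ^ j * m ^ 4 + K / a\<^sup>2) + K / a)"
    using a01 K0 by (simp add: ennreal_mult')
  also have "(1 - a) * ((1 - a) ^ j * m ^ 4 + K / a\<^sup>2) + K / a = (1 - a) ^ Suc j * m ^ 4 + K / a\<^sup>2"
    using a01 by (simp add: field_simps power2_eq_square)
  finally show ?case by (simp add: a_def K_def)
qed

end

section \<open>From fourth moments to the mean square error\<close>

text \<open>Cauchy-Schwarz moves the square inside the average. The weight \<delta> is left free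
  because \<open>m ^ 4\<close> does not become small: the factor \<delta> must make its contribution
  small, at the price of \<open>1 / \<delta>\<close> on the deviations.\<close>

lemma square_average_error_le:
  fixes th :: "nat \<Rightarrow> real" and m p \<delta> :: real
  assumes M: "0 < M" and \<delta>: "0 < \<delta>"
  shows "((1 / real M) * (\<Sum>j<M. (th j)\<^sup>2) - (m\<^sup>2 + p))\<^sup>2
    \<le> (4 + 8 / \<delta>) / real M * (\<Sum>j<M. (th j - m) ^ 4) + (8 * \<delta> * m ^ 4 + 2 * p\<^sup>2)"
proof -
  have sq: "(x - y)\<^sup>2 \<le> 2 * x\<^sup>2 + 2 * y\<^sup>2" for x y :: real
    using zero_le_power2[of "x + y"] by (simp add: power2_eq_square algebra_simps)
  define x where "x = (\<Sum>j<M. (th j)\<^sup>2 - m\<^sup>2)"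
  have "(1 / real M) * (\<Sum>j<M. (th j)\<^sup>2) - (m\<^sup>2 + p) = x / M - p"
    using M by (simp add: x_def sum_subtractf field_simps)
  then have 1: "((1 / real M) * (\<Sum>j<M. (th j)\<^sup>2) - (m\<^sup>2 + p))\<^sup>2 \<le> 2 * (x\<^sup>2 / (real M)\<^sup>2) + 2 * p\<^sup>2"
    using sq[of "x / M" p] by (simp only: power_divide times_divide_eq_right)
  have "x\<^sup>2 \<le> M * (\<Sum>j<M. ((th j)\<^sup>2 - m\<^sup>2)\<^sup>2)"
    using sum_squared_le_sum_of_squares[of "\<lambda>j. (th j)\<^sup>2 - m\<^sup>2" "{..<M}"]
    by (simp add: x_def mult.commute)
  also have "\<dots> \<le> M * (\<Sum>j<M. (2 + 4 / \<delta>) * (th j - m) ^ 4 + 4 * \<delta> * m ^ 4)"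
  proof (intro mult_left_mono sum_mono)
    fix j
    define D where "D = th j - m"
    have "(th j)\<^sup>2 - m\<^sup>2 = D\<^sup>2 - (- 2 * m * D)"
      by (simp add: D_def power2_eq_square algebra_simps)
    then have "((th j)\<^sup>2 - m\<^sup>2)\<^sup>2 \<le> 2 * D ^ 4 + 8 * (m\<^sup>2 * D\<^sup>2)"
      using sq[of "D\<^sup>2" "- 2 * m * D"] by (simp add: power_mult_distrib)
    \<comment> \<open>Young's inequality with weight \<delta> for the cross term
      \<open>2 * m * D\<close>.\<close>
    moreover have "8 * (m\<^sup>2 * D\<^sup>2) = 4 * \<delta> * m ^ 4 + 4 / \<delta> * D ^ 4 - 4 / \<delta> * (\<delta> * m\<^sup>2 - D\<^sup>2)\<^sup>2"
      using \<delta> by (simp add: field_simps power2_eq_square power4_eq_xxxx)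
    moreover have "0 \<le> 4 / \<delta> * (\<delta> * m\<^sup>2 - D\<^sup>2)\<^sup>2" using \<delta> by simp
    ultimately show "((th j)\<^sup>2 - m\<^sup>2)\<^sup>2 \<le> (2 + 4 / \<delta>) * (th j - m) ^ 4 + 4 * \<delta> * m ^ 4"
      unfolding D_def[symmetric] distrib_right by linarith
  qed simp
  also have "\<dots> = M * ((2 + 4 / \<delta>) * (\<Sum>j<M. (th j - m) ^ 4) + M * (4 * \<delta> * m ^ 4))"
    by (simp add: sum.distrib sum_distrib_left)
  finally have "2 * (x\<^sup>2 / (real M)\<^sup>2) \<le> 2 * (M * ((2 + 4 / \<delta>) * (\<Sum>j<M. (th j - m) ^ 4) + M * (4 * \<delta> * m ^ 4)) / (real M)\<^sup>2)"
    by (intro mult_left_mono divide_right_mono) auto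
  also have "\<dots> = (4 + 8 / \<delta>) / real M * (\<Sum>j<M. (th j - m) ^ 4) + 8 * \<delta> * m ^ 4"
    using M \<delta> by (simp add: field_simps power2_eq_square)
  finally show ?thesis using 1 by linarith
qed

text \<open>In the average over \<open>j\<close>, the transient part
  \<open>(1 - A * h) ^ j * m ^ 4\<close> sums to a geometric series of order
  \<open>1 / (A * h)\<close> and gains the factor \<open>1 / M\<close>; the stationary part is
  unaffected.\<close>

lemma sgld_square_error_le:
  fixes A h m p Q \<delta> :: real and b :: "'t \<Rightarrow> real" and S :: "'t set" and M :: nat
  assumes h: "0 < h" and a: "0 < A * h" "A * h \<le> 1"
    and S: "finite S" "S \<noteq> {}"
    and b_mean: "(\<Sum>s\<in>S. b s) = real (card S) * (A * m)"
    and b_fourth: "(\<Sum>s\<in>S. (h * (b s - A * m)) ^ 4) \<le> real (card S) * Q"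
    and M: "0 < M" and \<delta>: "0 < \<delta>"
  shows "(\<integral>\<^sup>+ (xi, tau). ennreal (((1 / real M) * (\<Sum>j<M. (sgld_theta A h (\<lambda>k. b (tau k)) xi j)\<^sup>2) - (m\<^sup>2 + p))\<^sup>2)
      \<partial>(PiM {..<M} (\<lambda>_. density lborel (normal_density 0 1))
        \<Otimes>\<^sub>M PiM {..<M} (\<lambda>_. measure_pmf (pmf_of_set S))))
    \<le> ennreal ((4 + 8 / \<delta>) * (m ^ 4 / (M * (A * h)) + 152 * (Q + 3 * h\<^sup>2) / (A * h)\<^sup>2) + (8 * \<delta> * m ^ 4 + 2 * p\<^sup>2))"
proof -
  let ?NM = "PiM {..<M} (\<lambda>_. density lborel (normal_density 0 1))"
  let ?TM = "PiM {..<M} (\<lambda>_. measure_pmf (pmf_of_set S))"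
  define D where "D z j = sgld_theta A h (\<lambda>k. b (snd z k)) (fst z) j - m" for z :: "(nat \<Rightarrow> real) \<times> (nat \<Rightarrow> 't)" and j
  define K where "K = 152 * (Q + 3 * h\<^sup>2) / (A * h)\<^sup>2"
  define c where "c = (4 + 8 / \<delta>) / M"
  define e where "e = 8 * \<delta> * m ^ 4 + 2 * p\<^sup>2"
  have c0: "0 \<le> c" and e0: "0 \<le> e" using M \<delta> by (auto simp: c_def e_def)
  have "0 \<le> real (card S) * Q" by (rule order_trans[OF _ b_fourth]) (auto intro: sum_nonneg)
  then have "0 \<le> Q" using S by (simp add: zero_le_mult_iff card_gt_0_iff)
  then have K0: "0 \<le> K" by (simp add: K_def)
  interpret NM: prob_space ?NM by (intro prob_space_PiM prob_space_normal_density) simp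
  interpret TM: prob_space ?TM by (intro prob_space_PiM) (simp add: prob_space_measure_pmf)
  interpret PP: pair_prob_space ?NM ?TM ..
  have mD: "(\<lambda>z. ennreal (D z j ^ 4)) \<in> borel_measurable (?NM \<Otimes>\<^sub>M ?TM)" if "j < M" for j
  proof -
    have [measurable]: "(\<lambda>z. sgld_theta A h (\<lambda>k. b (snd z k)) (fst z) j) \<in> borel_measurable (?NM \<Otimes>\<^sub>M ?TM)"
      using that by (intro measurable_sgld_theta) simp
    show ?thesis unfolding D_def by measurable
  qed
  have D4: "(\<integral>\<^sup>+ z. ennreal (D z j ^ 4) \<partial>(?NM \<Otimes>\<^sub>M ?TM)) \<le> ennreal ((1 - A * h) ^ j * m ^ 4 + K)" if "j < M" for j
    using sgld_fourth_moment_le[OF assms(1-7), of j M] that by (simp add: D_def K_def case_prod_unfold)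
  have "(\<integral>\<^sup>+ (xi, tau). ennreal (((1 / real M) * (\<Sum>j<M. (sgld_theta A h (\<lambda>k. b (tau k)) xi j)\<^sup>2) - (m\<^sup>2 + p))\<^sup>2)
      \<partial>(?NM \<Otimes>\<^sub>M ?TM)) \<le> (\<integral>\<^sup>+ z. ennreal (c * (\<Sum>j<M. D z j ^ 4) + e) \<partial>(?NM \<Otimes>\<^sub>M ?TM))"
    unfolding D_def c_def e_def case_prod_unfold
    by (intro nn_integral_mono ennreal_leI square_average_error_le M \<delta>)
  also have "\<dots> = (\<integral>\<^sup>+ z. ennreal c * (\<Sum>j<M. ennreal (D z j ^ 4)) + ennreal e \<partial>(?NM \<Otimes>\<^sub>M ?TM))"
    using c0 e0 by (simp add: sum_nonneg flip: ennreal_mult' ennreal_plus)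
  also have "\<dots> = ennreal c * (\<Sum>j<M. \<integral>\<^sup>+ z. ennreal (D z j ^ 4) \<partial>(?NM \<Otimes>\<^sub>M ?TM)) + ennreal e"
  proof -
    have "(\<integral>\<^sup>+ z. (\<Sum>j<M. ennreal (D z j ^ 4)) \<partial>(?NM \<Otimes>\<^sub>M ?TM)) = (\<Sum>j<M. \<integral>\<^sup>+ z. ennreal (D z j ^ 4) \<partial>(?NM \<Otimes>\<^sub>M ?TM))"
      by (intro nn_integral_sum mD) simp
    then show ?thesis
      using mD PP.emeasure_space_1 by (simp add: nn_integral_add nn_integral_cmult del: sum_ennreal)
  qed
  also have "\<dots> \<le> ennreal c * (\<Sum>j<M. ennreal ((1 - A * h) ^ j * m ^ 4 + K)) + ennreal e"
    by (intro add_mono mult_left_mono sum_mono D4) auto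
  also have "\<dots> = ennreal (c * (\<Sum>j<M. (1 - A * h) ^ j * m ^ 4 + K) + e)"
  proof -
    have "\<And>j. 0 \<le> (1 - A * h) ^ j * m ^ 4 + K" using a K0 by simp
    then show ?thesis using c0 e0 by (simp add: ennreal_mult' sum_nonneg)
  qed
  also have "\<dots> \<le> ennreal ((4 + 8 / \<delta>) * (m ^ 4 / (M * (A * h)) + K) + e)"
  proof -
    have "(\<Sum>j<M. (1 - A * h) ^ j) = (1 - (1 - A * h) ^ M) / (A * h)"
      using a by (auto simp: sum_gp_strict)
    also have "\<dots> \<le> 1 / (A * h)" using a by (intro divide_right_mono) auto
    finally have "(\<Sum>j<M. (1 - A * h) ^ j) * m ^ 4 \<le> 1 / (A * h) * m ^ 4"
      by (intro mult_right_mono) auto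
    then have "c * (\<Sum>j<M. (1 - A * h) ^ j * m ^ 4 + K) \<le> c * (1 / (A * h) * m ^ 4 + M * K)"
      using c0 by (intro mult_left_mono) (auto simp: sum.distrib sum_distrib_right)
    also have "\<dots> = (4 + 8 / \<delta>) * (m ^ 4 / (M * (A * h)) + K)"
    proof -
      have "w / M * (1 / (A * h) * m ^ 4 + M * K) = w * (m ^ 4 / (M * (A * h)) + K)" for w
        using M by (simp add: distrib_left)
      then show ?thesis by (simp add: c_def)
    qed
    finally show ?thesis by (simp add: ennreal_leI)
  qed
  finally show ?thesis unfolding K_def e_def .
qed

section \<open>Subsets of size one and moments of the data\<close>

lemma subsets_of_size_1: "subsets_of_size N 1 = (\<lambda>i. {i}) ` {1..N}"
  by (auto simp: subsets_of_size_def card_1_singleton_iff)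

lemma sum_subsets_of_size_1: "(\<Sum>s\<in>subsets_of_size N 1. f s) = (\<Sum>i=1..N. f {i})"
  unfolding subsets_of_size_1 by (subst sum.reindex) (auto simp: inj_on_def)

lemma card_subsets_of_size_1: "card (subsets_of_size N 1) = N"
  unfolding subsets_of_size_1 by (subst card_image) (auto simp: inj_on_def)

text \<open>Without the prior term in the denominator this is the power mean inequality for the
  sample mean. All data dependence is thus reduced to the average of \<open>X i ^ 4\<close>.\<close>

lemma post_mean_power4_le:
  assumes "0 < N"
  shows "post_mean st sx N X ^ 4 \<le> (\<Sum>i=1..N. X i ^ 4) / N"
proof -
  have "post_mean st sx N X ^ 4 = (\<Sum>i=1..N. X i) ^ 4 / (sx\<^sup>2 / st\<^sup>2 + N) ^ 4"
    by (simp add: post_mean_def power_divide)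
  also have "\<dots> \<le> (\<Sum>i=1..N. X i) ^ 4 / real N ^ 4"
    using assms by (intro divide_left_mono power_mono mult_pos_pos zero_less_power add_nonneg_pos) auto
  also have "\<dots> \<le> real N ^ 3 * (\<Sum>i=1..N. X i ^ 4) / real N ^ 4"
    using sum_power4_le[of "{1..N}" X] by (intro divide_right_mono) auto
  also have "\<dots> = (\<Sum>i=1..N. X i ^ 4) / N"
    using assms by (simp add: field_simps power3_eq_cube power4_eq_xxxx)
  finally show ?thesis .
qed

text \<open>The right side is the mean of \<open>N * X i / (2 * sx\<^sup>2)\<close> over a uniform
  index, so this is the unbiasedness \<open>b_mean\<close>.\<close>

lemma drift_post_mean:
  assumes "0 < N" "st > 0" "sx > 0"
  shows "(1 / st\<^sup>2 + real N / sx\<^sup>2) / 2 * post_mean st sx N X = (\<Sum>i=1..N. X i) / (2 * sx\<^sup>2)"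
proof -
  have "(1 / st\<^sup>2 + real N / sx\<^sup>2) / 2 = (sx\<^sup>2 / st\<^sup>2 + real N) / (2 * sx\<^sup>2)"
    using assms by (simp add: field_simps)
  moreover have "sx\<^sup>2 / st\<^sup>2 + real N > 0" using assms by (intro add_pos_pos) auto
  ultimately show ?thesis unfolding post_mean_def by (simp only: times_divide_times_eq) simp
qed

text \<open>Supplies \<open>b_fourth\<close>. The individual term and the total contribute the same
  bound, 8 each, and the sum 16 cancels the fourth power of the 2 in
  \<open>2 * sx\<^sup>2\<close>.\<close>

lemma subsampling_fourth_moment_le:
  fixes X :: "nat \<Rightarrow> real"
  assumes "0 < N" "sx > 0"
  shows "(\<Sum>i=1..N. (h * (real N * X i / (2 * sx\<^sup>2) - (\<Sum>i=1..N. X i) / (2 * sx\<^sup>2))) ^ 4)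
    \<le> N * ((h * real N) ^ 4 / sx ^ 8 * ((\<Sum>i=1..N. X i ^ 4) / N))"
proof -
  define T where "T = (\<Sum>i=1..N. X i)"
  define k where "k = h ^ 4 / (16 * sx ^ 8)"
  have k0: "0 \<le> k" by (simp add: k_def)
  have "(h * (real N * X i / (2 * sx\<^sup>2) - T / (2 * sx\<^sup>2))) ^ 4 \<le> k * (8 * (N * X i) ^ 4 + 8 * T ^ 4)" for i
  proof -
    have "h * (real N * X i / (2 * sx\<^sup>2) - T / (2 * sx\<^sup>2)) = h * (N * X i + (- T)) / (2 * sx\<^sup>2)"
      by (simp add: diff_divide_distrib right_diff_distrib)
    then have "(h * (real N * X i / (2 * sx\<^sup>2) - T / (2 * sx\<^sup>2))) ^ 4 = k * (N * X i + (- T)) ^ 4"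
      by (simp add: k_def power_divide power_mult_distrib flip: power_mult)
    also have "\<dots> \<le> k * (8 * (N * X i) ^ 4 + 8 * (- T) ^ 4)"
      by (intro mult_left_mono fourth_power_add_le k0)
    finally show ?thesis by simp
  qed
  then have "(\<Sum>i=1..N. (h * (real N * X i / (2 * sx\<^sup>2) - T / (2 * sx\<^sup>2))) ^ 4)
      \<le> (\<Sum>i=1..N. k * (8 * (N * X i) ^ 4 + 8 * T ^ 4))"
    by (intro sum_mono)
  also have "\<dots> = k * (8 * (real N ^ 4 * (\<Sum>i=1..N. X i ^ 4)) + 8 * (N * T ^ 4))"
    by (simp add: sum.distrib sum_distrib_left power_mult_distrib algebra_simps)
  also have "\<dots> \<le> k * (8 * (real N ^ 4 * (\<Sum>i=1..N. X i ^ 4)) + 8 * (N * (real N ^ 3 * (\<Sum>i=1..N. X i ^ 4))))"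
    using sum_power4_le[of "{1..N}" X] unfolding T_def
    by (intro mult_left_mono add_mono k0) auto
  also have "\<dots> = N * ((h * real N) ^ 4 / sx ^ 8 * ((\<Sum>i=1..N. X i ^ 4) / N))"
    using assms by (simp add: k_def field_simps power3_eq_cube power4_eq_xxxx)
  finally show ?thesis unfolding T_def .
qed

lemma nn_integral_average_fourth_moment_le:
  fixes N :: nat
  assumes "0 < N" "0 < s" "0 \<le> \<alpha>" "0 \<le> \<beta>"
  shows "(\<integral>\<^sup>+ X. ennreal (\<alpha> * ((\<Sum>i=1..N. X i ^ 4) / real N) + \<beta>) \<partial>PiM {1..N} (\<lambda>_. density lborel (normal_density m s)))
    \<le> ennreal (\<alpha> * (24 * s ^ 4 + 8 * m ^ 4) + \<beta>)"
proof -
  let ?G = "\<lambda>_::nat. density lborel (normal_density m s)"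
  interpret prob_space "PiM {1..N} ?G" using assms by (intro prob_space_PiM prob_space_normal_density)
  have meas [measurable]: "(\<lambda>X. X i) \<in> borel_measurable (PiM {1..N} ?G)" if "i \<in> {1..N}" for i
    using measurable_component_singleton[OF that, of ?G] by simp
  have comp: "(\<integral>\<^sup>+ X. ennreal (X i ^ 4) \<partial>PiM {1..N} ?G) \<le> ennreal (24 * s ^ 4 + 8 * m ^ 4)" if i: "i \<in> {1..N}" for i
  proof -
    \<comment> \<open>Resampling coordinate \<open>i\<close> yields its marginal, since the
      integrand sees nothing else.\<close>
    have "(\<integral>\<^sup>+ X. ennreal (X i ^ 4) \<partial>PiM {1..N} ?G) = (\<integral>\<^sup>+ X. \<integral>\<^sup>+ y. ennreal ((X(i := y)) i ^ 4) \<partial>?G i \<partial>PiM {1..N} ?G)"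
      using i assms meas[OF i] by (intro nn_integral_PiM_resample prob_space_normal_density) auto
    also have "\<dots> = (\<integral>\<^sup>+ y. ennreal (y ^ 4) \<partial>?G i)" using emeasure_space_1 by simp
    finally show ?thesis using nn_integral_normal_fourth_moment_le[OF assms(2), of m] by simp
  qed
  have "(\<integral>\<^sup>+ X. ennreal (\<alpha> * ((\<Sum>i=1..N. X i ^ 4) / real N) + \<beta>) \<partial>PiM {1..N} ?G)
      = (\<integral>\<^sup>+ X. ennreal (\<alpha> / N) * (\<Sum>i=1..N. ennreal (X i ^ 4)) + ennreal \<beta> \<partial>PiM {1..N} ?G)"
    using assms by (simp add: ennreal_mult'[symmetric] sum_nonneg flip: ennreal_plus)
  also have "\<dots> = ennreal (\<alpha> / N) * (\<Sum>i=1..N. \<integral>\<^sup>+ X. ennreal (X i ^ 4) \<partial>PiM {1..N} ?G) + ennreal \<beta>"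
  proof -
    have m4: "(\<lambda>X. ennreal (X i ^ 4)) \<in> borel_measurable (PiM {1..N} ?G)" if "i \<in> {1..N}" for i
      using meas[OF that] by measurable
    have "(\<integral>\<^sup>+ X. (\<Sum>i=1..N. ennreal (X i ^ 4)) \<partial>PiM {1..N} ?G) = (\<Sum>i=1..N. \<integral>\<^sup>+ X. ennreal (X i ^ 4) \<partial>PiM {1..N} ?G)"
      by (intro nn_integral_sum m4)
    then show ?thesis
      using m4 emeasure_space_1 by (simp add: nn_integral_add nn_integral_cmult del: sum_ennreal)
  qed
  also have "\<dots> \<le> ennreal (\<alpha> / N) * (\<Sum>i=1..N. ennreal (24 * s ^ 4 + 8 * m ^ 4)) + ennreal \<beta>"
    by (intro add_mono mult_left_mono sum_mono comp) auto
  also have "\<dots> = ennreal (\<alpha> / N * (N * (24 * s ^ 4 + 8 * m ^ 4)) + \<beta>)"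
  proof -
    define k where "k = 24 * s ^ 4 + 8 * m ^ 4"
    have "0 \<le> k" by (simp add: k_def)
    then show ?thesis
      unfolding k_def[symmetric] using assms
      by (simp add: ennreal_of_nat_eq_real_of_nat flip: ennreal_mult' ennreal_plus)
  qed
  finally show ?thesis using assms by simp
qed

section \<open>The error bound over the joint space\<close>

text \<open>For fixed data the bound is affine in the average of \<open>X i ^ 4\<close> with
  nonnegative coefficients, so integrating over the data replaces that average by its moment bound
  \<open>C\<close>, which is free of \<open>N\<close>.\<close>

lemma sgld_joint_error_le:
  fixes st sx h \<delta> :: real and N M :: nat
  defines "A \<equiv> (1 / st\<^sup>2 + real N / sx\<^sup>2) / 2" and "C \<equiv> 24 * sx ^ 4 + 8"
  assumes st: "st > 0" and sx: "sx > 0" and N: "0 < N" and h: "0 < h" and a: "A * h \<le> 1"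
    and M: "0 < M" and \<delta>: "0 < \<delta>"
  shows "(\<integral>\<^sup>+ \<omega>. (case \<omega> of (X, xi, tau) \<Rightarrow>
            ennreal (((1 / real M) * (\<Sum>j<M.
                (sgld_theta A h (\<lambda>k. (real N / real 1) * (\<Sum>i\<in>tau k. X i) / (2 * sx\<^sup>2)) xi j)\<^sup>2)
              - ((post_mean st sx N X)\<^sup>2 + post_var st sx N))\<^sup>2))
         \<partial>(sgld_space sx N 1 M))
    \<le> ennreal ((4 + 8 / \<delta>) * (C / (M * (A * h)) + 152 * ((h * real N) ^ 4 / sx ^ 8 * C + 3 * h\<^sup>2) / (A * h)\<^sup>2)
        + 8 * \<delta> * C + 2 * (post_var st sx N)\<^sup>2)"
proof -
  let ?XM = "PiM {1..N} (\<lambda>_. density lborel (normal_density 1 sx))"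
  let ?NM = "PiM {..<M} (\<lambda>_. density lborel (normal_density 0 1))"
  let ?TM = "PiM {..<M} (\<lambda>_. measure_pmf (pmf_of_set (subsets_of_size N 1)))"
  let ?f = "\<lambda>X xi tau. ennreal (((1 / real M) * (\<Sum>j<M.
                (sgld_theta A h (\<lambda>k. (real N / real 1) * (\<Sum>i\<in>tau k. X i) / (2 * sx\<^sup>2)) xi j)\<^sup>2)
              - ((post_mean st sx N X)\<^sup>2 + post_var st sx N))\<^sup>2)"
  have A0: "0 < A" using st sx N by (simp add: A_def add_pos_pos)
  have a0: "0 < A * h" using A0 h by simp
  define Y where "Y X = (\<Sum>i=1..N. X i ^ 4) / N" for X :: "nat \<Rightarrow> real"
  define \<alpha> where "\<alpha> = (4 + 8 / \<delta>) * (1 / (M * (A * h)) + 152 * ((h * real N) ^ 4 / sx ^ 8) / (A * h)\<^sup>2) + 8 * \<delta>"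
  define \<beta> where "\<beta> = (4 + 8 / \<delta>) * (152 * (3 * h\<^sup>2) / (A * h)\<^sup>2) + 2 * (post_var st sx N)\<^sup>2"
  have \<alpha>\<beta>: "0 \<le> \<alpha>" "0 \<le> \<beta>" using a0 \<delta> sx by (auto simp: \<alpha>_def \<beta>_def)
  interpret NM: prob_space ?NM by (intro prob_space_PiM prob_space_normal_density) simp
  interpret TM: prob_space ?TM by (intro prob_space_PiM) (simp add: prob_space_measure_pmf)
  interpret PP: pair_prob_space ?NM ?TM ..
  have inner: "(\<integral>\<^sup>+ (xi, tau). ?f X xi tau \<partial>(?NM \<Otimes>\<^sub>M ?TM)) \<le> ennreal (\<alpha> * Y X + \<beta>)" for X
  proof -
    let ?S = "subsets_of_size N 1"
    let ?b = "\<lambda>s. (real N / real 1) * (\<Sum>i\<in>s. X i) / (2 * sx\<^sup>2)"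
    let ?m = "post_mean st sx N X"
    have Am: "A * ?m = (\<Sum>i=1..N. X i) / (2 * sx\<^sup>2)"
      unfolding A_def using N st sx by (rule drift_post_mean)
    have S: "finite ?S" "?S \<noteq> {}" using N unfolding subsets_of_size_1 by auto
    have b1: "(\<Sum>s\<in>?S. ?b s) = real (card ?S) * (A * ?m)"
      unfolding sum_subsets_of_size_1 card_subsets_of_size_1 Am
      by (simp add: sum_distrib_left sum_divide_distrib)
    have b4: "(\<Sum>s\<in>?S. (h * (?b s - A * ?m)) ^ 4) \<le> real (card ?S) * ((h * real N) ^ 4 / sx ^ 8 * Y X)"
      unfolding sum_subsets_of_size_1 card_subsets_of_size_1 Am Y_def
      using subsampling_fourth_moment_le[OF N sx, of h X] by simp
    have "(\<integral>\<^sup>+ (xi, tau). ?f X xi tau \<partial>(?NM \<Otimes>\<^sub>M ?TM)) \<le>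
      ennreal ((4 + 8 / \<delta>) * (?m ^ 4 / (M * (A * h)) + 152 * ((h * real N) ^ 4 / sx ^ 8 * Y X + 3 * h\<^sup>2) / (A * h)\<^sup>2)
        + (8 * \<delta> * ?m ^ 4 + 2 * (post_var st sx N)\<^sup>2))"
      by (rule sgld_square_error_le[OF h a0 a S b1 b4 M \<delta>])
    also have "\<dots> \<le> ennreal ((4 + 8 / \<delta>) * (Y X / (M * (A * h)) + 152 * ((h * real N) ^ 4 / sx ^ 8 * Y X + 3 * h\<^sup>2) / (A * h)\<^sup>2)
        + (8 * \<delta> * Y X + 2 * (post_var st sx N)\<^sup>2))"
      using a0 \<delta> post_mean_power4_le[OF N, of st sx X] unfolding Y_def
      by (intro ennreal_leI add_mono mult_left_mono divide_right_mono) auto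
    also have "\<dots> = ennreal (\<alpha> * Y X + \<beta>)"
      by (simp add: \<alpha>_def \<beta>_def distrib_left distrib_right add_divide_distrib mult.assoc add_ac)
    finally show ?thesis .
  qed
  have "(\<integral>\<^sup>+ (X, xi, tau). ?f X xi tau \<partial>(sgld_space sx N 1 M)) \<le>
      (\<integral>\<^sup>+ X. \<integral>\<^sup>+ (xi, tau). ?f X xi tau \<partial>(?NM \<Otimes>\<^sub>M ?TM) \<partial>?XM)"
    unfolding sgld_space_def
    by (rule order_trans[OF nn_integral_pair_measure_le[OF PP.sigma_finite_measure_axioms]]) simp
  also have "\<dots> \<le> (\<integral>\<^sup>+ X. ennreal (\<alpha> * Y X + \<beta>) \<partial>?XM)"
    by (intro nn_integral_mono inner)
  also have "\<dots> \<le> ennreal (\<alpha> * C + \<beta>)"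
    using nn_integral_average_fourth_moment_le[OF N sx \<alpha>\<beta>, of 1] by (simp add: Y_def C_def)
  also have "\<alpha> * C + \<beta> = (4 + 8 / \<delta>) * (C / (M * (A * h)) + 152 * ((h * real N) ^ 4 / sx ^ 8 * C + 3 * h\<^sup>2) / (A * h)\<^sup>2)
        + 8 * \<delta> * C + 2 * (post_var st sx N)\<^sup>2"
    by (simp add: \<alpha>_def \<beta>_def distrib_left distrib_right add_divide_distrib mult.assoc add_ac)
  finally show ?thesis .
qed

section \<open>Rates in \<open>N\<close> and the limit\<close>

theorem theorem4:
  fixes st sx \<epsilon> :: real
  assumes "st > 0" and "sx > 0" and "\<epsilon> > 0"
  shows "(\<lambda>N::nat.
           let h = real N powr (-1 - \<epsilon>);
               M = nat \<lfloor>real N powr (1 + 2 * \<epsilon>)\<rfloor>;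
               n = (1::nat);
               A = (1 / st\<^sup>2 + real N / sx\<^sup>2) / 2
           in \<integral>\<^sup>+ \<omega>. (case \<omega> of (X, xi, tau) \<Rightarrow>
                 ennreal (((1 / real M) * (\<Sum>j<M.
                     (sgld_theta A h (\<lambda>k. (real N / real n) * (\<Sum>i\<in>tau k. X i) / (2 * sx\<^sup>2)) xi j)\<^sup>2)
                   - ((post_mean st sx N X)\<^sup>2 + post_var st sx N))\<^sup>2))
              \<partial>(sgld_space sx N n M))
         \<longlonglongrightarrow> 0"
proof -
  define h where "h N = real N powr (-1 - \<epsilon>)" for N :: nat
  define M where "M N = nat \<lfloor>real N powr (1 + 2 * \<epsilon>)\<rfloor>" for N :: nat
  define A where "A N = (1 / st\<^sup>2 + real N / sx\<^sup>2) / 2" for N :: nat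
  define C where "C = 24 * sx ^ 4 + 8"
  define R where "R N = C / (M N * (A N * h N)) + 152 * ((h N * N) ^ 4 / sx ^ 8 * C + 3 * (h N)\<^sup>2) / (A N * h N)\<^sup>2"
    for N :: nat
  define E where "E N = (\<integral>\<^sup>+ \<omega>. (case \<omega> of (X, xi, tau) \<Rightarrow>
                 ennreal (((1 / real (M N)) * (\<Sum>j<M N.
                     (sgld_theta (A N) (h N) (\<lambda>k. (real N / real 1) * (\<Sum>i\<in>tau k. X i) / (2 * sx\<^sup>2)) xi j)\<^sup>2)
                   - ((post_mean st sx N X)\<^sup>2 + post_var st sx N))\<^sup>2))
              \<partial>(sgld_space sx N 1 (M N)))" for N :: nat
  have C0: "0 < C" unfolding C_def using assms by (intro add_nonneg_pos) auto
  have A0: "0 < A N" if "0 < N" for N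
    using assms that by (simp add: A_def add_pos_pos)
  \<comment> \<open>The floor costs at most 1, so \<open>M N\<close> can be replaced by an explicit
    power below it.\<close>
  have Mge: "real N powr (1 + 2 * \<epsilon>) - 1 \<le> real (M N)" for N
    unfolding M_def by linarith
  have a0: "(\<lambda>N. A N * h N) \<longlonglongrightarrow> 0"
    unfolding A_def h_def using assms by real_asymp
  have M1: "eventually (\<lambda>N. real N powr (1 + 2 * \<epsilon>) - 1 > 0) sequentially"
    using assms by real_asymp
  \<comment> \<open>\<open>A N * h N\<close> has order \<open>N powr (- \<epsilon>)\<close>, so the
    product grows like \<open>N powr (1 + \<epsilon>)\<close>.\<close>
  have "filterlim (\<lambda>N. (real N powr (1 + 2 * \<epsilon>) - 1) * (A N * h N)) at_top sequentially"
    unfolding A_def h_def using assms by real_asymp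
  then have "filterlim (\<lambda>N. real (M N) * (A N * h N)) at_top sequentially"
    by (rule filterlim_at_top_mono)
       (use A0 in \<open>auto intro!: eventually_mono[OF eventually_gt_at_top[of 0]] mult_right_mono Mge simp: h_def less_imp_le\<close>)
  then have R1: "(\<lambda>N. C / (M N * (A N * h N))) \<longlonglongrightarrow> 0"
    by (intro tendsto_divide_0[OF tendsto_const] filterlim_at_top_imp_at_infinity)
  have R2: "(\<lambda>N. 152 * ((h N * N) ^ 4 / sx ^ 8 * C + 3 * (h N)\<^sup>2) / (A N * h N)\<^sup>2) \<longlonglongrightarrow> 0"
  proof -
    \<comment> \<open>The subsampling part has order \<open>N powr (- 2 * \<epsilon>)\<close>; the
      Gaussian part below is \<open>1 / (A N)\<^sup>2\<close>, of order
      \<open>N powr (- 2)\<close>.\<close>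
    have 1: "(\<lambda>N. (h N * N) ^ 4 / (A N * h N)\<^sup>2) \<longlonglongrightarrow> 0"
      unfolding A_def h_def using assms by real_asymp
    have 2: "(\<lambda>N. (h N)\<^sup>2 / (A N * h N)\<^sup>2) \<longlonglongrightarrow> 0"
      unfolding A_def h_def using assms by real_asymp
    \<comment> \<open>For \<open>d = 0\<close> every quotient by \<open>d\<close> is 0, so the
      identity is unconditional and can be used for rewriting.\<close>
    have eq: "152 * (x / sx ^ 8 * C + 3 * y) / d = 152 * C / sx ^ 8 * (x / d) + 456 * (y / d)" for x y d
      using assms by (cases "d = 0") (simp_all add: field_simps)
    show ?thesis
      unfolding eq
      using tendsto_add[OF tendsto_mult_left[OF 1, of "152 * C / sx ^ 8"] tendsto_mult_left[OF 2, of 456]]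
      by simp
  qed
  have R0: "R \<longlonglongrightarrow> 0"
    using tendsto_add[OF R1 R2] by (simp add: R_def[abs_def])
  have V0: "(\<lambda>N. post_var st sx N) \<longlonglongrightarrow> 0"
    unfolding post_var_def using assms by real_asymp
  \<comment> \<open>The choice \<open>\<delta> = sqrt (R N)\<close> balances the two terms of the error bound.\<close>
  define U where "U N = 4 * R N + 8 * sqrt (R N) + 8 * sqrt (R N) * C + 2 * (post_var st sx N)\<^sup>2" for N
  have "U \<longlonglongrightarrow> 4 * 0 + 8 * sqrt 0 + 8 * sqrt 0 * C + 2 * 0\<^sup>2"
    unfolding U_def by (intro tendsto_intros R0 V0)
  then have U0: "(\<lambda>N. ennreal (U N)) \<longlonglongrightarrow> 0"
    using tendsto_ennrealI by fastforce
  have ev: "eventually (\<lambda>N. E N \<le> ennreal (U N)) sequentially"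
    \<comment> \<open>The limit \<open>a0\<close> eventually gives \<open>A N * h N < 1\<close>, the
      contraction condition.\<close>
    using eventually_gt_at_top[of 0] order_tendstoD(2)[OF a0, of 1, simplified] M1
  proof eventually_elim
    case (elim N)
    have h0: "0 < h N" using elim by (simp add: h_def)
    have "0 < real (M N)" using Mge[of N] elim by linarith
    then have M0: "0 < M N" by simp
    \<comment> \<open>Strict positivity, which makes \<open>sqrt (R N)\<close> an admissible
      \<delta>, comes from the transient term and \<open>C > 0\<close>.\<close>
    have R0: "0 < R N"
      unfolding R_def using A0[of N] elim h0 M0 C0
      by (intro add_pos_nonneg divide_pos_pos mult_pos_pos) auto
    have "E N \<le> ennreal ((4 + 8 / sqrt (R N)) * R N + 8 * sqrt (R N) * C + 2 * (post_var st sx N)\<^sup>2)"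
      unfolding E_def R_def C_def A_def
      using sgld_joint_error_le[OF assms(1,2) elim(1) h0 _ M0, of "sqrt (R N)"] elim(2) R0
      by (simp add: R_def C_def A_def)
    also have "(4 + 8 / sqrt (R N)) * R N = 4 * R N + 8 * sqrt (R N)"
      using R0 real_div_sqrt[of "R N"] by (simp add: distrib_right flip: times_divide_eq_right)
    finally show ?case by (simp add: U_def)
  qed
  have "E \<longlonglongrightarrow> 0"
    by (rule tendsto_sandwich[OF _ ev tendsto_const U0]) simp
  then show ?thesis
    unfolding E_def A_def M_def h_def Let_def .
qed

end
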